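(* Let $\Sigma$ be any alphabet with $|\Sigma|\ge 2$ and let $L$ be any language over $\Sigma$. If $L\in\mathrm{CFL}/n$, then there exists an alphabet $\Gamma$ (a finite nonempty set) such that the following holds. For any triplet $(j_0,k_0,n)$ of integers with $j_0\ge 2$ and $2j_0\le k_0<n$, put $$\Delta_{j_0,k_0,n}=\{(i,j,u,v)\mid u,v\in\Gamma,\ i\in\{0,\dots,n\},\ j\in\{j_0,\dots,k_0\},\ i+j\le n\}.$$ Then there exist two families of sets $\{A_e\}_{e\in\Delta_{j_0,k_0,n}}$ and $\{B_e\}_{e\in\Delta_{j_0,k_0,n}}$ such that: (1) for every $e=(i,j,u,v)\in\Delta_{j_0,k_0,n}$, $A_e\subseteq\Sigma^i\times\Sigma^{n-i-j}$ and $B_e\subseteq\Sigma^j$; (2) for every string $w\in\Sigma^n$ with $|w|\ge 4$, $w\in L$ if and only if there exist an index $e=(i,j,u,v)\in\Delta_{j_0,k_0,n}$ and strings $x\in\Sigma^i$, $y\in\Sigma^j$, $z\in\Sigma^{n-i-j}$ with $w=xyz$, $(x,z)\in A_e$ and $y\in B_e$; (3) for every $e\in\Delta_{j_0,k_0,n}$ and any strings $x_1,x_2,y_1,y_2,z_1,z_2\in\Sigma^*$, if $(x_1,z_1,y_1),(x_2,z_2,y_2)\in A_e\times B_e$ then $(x_1,z_1,y_2),(x_2,z_2,y_1)\in A_e\times B_e$; (4) all product sets $A_e\times B_e$, $e\in\Delta_{j_0,k_0,n}$, are mutually disjoint.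
   Context: Elements $((x,z),y)$ of $A_e\times B_e$ are written as triples $(x,z,y)$. CFL is the family of context-free languages. For strings $x=x_1\cdots x_n\in\Sigma^n$, $y=y_1\cdots y_n\in\Theta^n$ of equal length, $[\begin{smallmatrix} x \\ y \end{smallmatrix}]$ denotes the string $[\begin{smallmatrix} x_1 \\ y_1 \end{smallmatrix}]\cdots[\begin{smallmatrix} x_n \\ y_n \end{smallmatrix}]$ over the alphabet of pairs $\Sigma\times\Theta$. A language $L$ over $\Sigma$ is in $\mathrm{CFL}/n$ if there are an alphabet $\Theta$, a function $h:\mathbb{N}\to\Theta^*$ with $|h(n)|=n$ for all $n$ (an arbitrary length-preserving advice function), and a context-free language $S$ over the pair alphabet such that for all $x\in\Sigma^*$: $x\in L\iff[\begin{smallmatrix} x \\ h(|x|) \end{smallmatrix}]\in S$. *)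

theory Defs
  imports Main "HOL-Library.Disjoint_Sets"
begin

definition alphabet :: "'a set \<Rightarrow> bool" where
  "alphabet \<Sigma> \<longleftrightarrow> finite \<Sigma> \<and> \<Sigma> \<noteq> {}"

definition words :: "'a set \<Rightarrow> nat \<Rightarrow> 'a list set" where
  "words \<Sigma> n = {w \<in> lists \<Sigma>. length w = n}"

datatype ('n, 't) symb = NT 'n | TM 't

record ('n, 't) cfg =
  nonterminals :: "'n set"
  terminals :: "'t set"
  start :: 'n
  productions :: "('n \<times> ('n, 't) symb list) set"

definition wf_cfg :: "('n, 't) cfg \<Rightarrow> bool" where
  "wf_cfg G \<longleftrightarrow> finite (nonterminals G) \<and> alphabet (terminals G)
    \<and> start G \<in> nonterminals G \<and> finite (productions G)
    \<and> productions G \<subseteq>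
        nonterminals G \<times> lists (NT ` nonterminals G \<union> TM ` terminals G)"

definition cfg_step :: "('n, 't) cfg \<Rightarrow> (('n, 't) symb list \<times> ('n, 't) symb list) set" where
  "cfg_step G = {(\<alpha> @ [NT X] @ \<beta>, \<alpha> @ \<gamma> @ \<beta>) | \<alpha> X \<beta> \<gamma>. (X, \<gamma>) \<in> productions G}"

definition cfg_lang :: "('n, 't) cfg \<Rightarrow> 't list set" where
  "cfg_lang G = {w \<in> lists (terminals G). ([NT (start G)], map TM w) \<in> (cfg_step G)\<^sup>*}"

(* Nonterminals are drawn from nat: a grammar has finitely many, so up to renaming this
   is no restriction.  The same applies to the advice alphabet in CFL_advice. *)
definition CFL :: "'t set \<Rightarrow> 't list set set" where
  "CFL \<Sigma> = {L. \<exists>G :: (nat, 't) cfg. wf_cfg G \<and> terminals G = \<Sigma> \<and> cfg_lang G = L}"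

(* The class CFL/n over the alphabet \<Sigma>.  Since x and h (length x) have equal length,
   zip x (h (length x)) is the two-track string and no symbol is dropped. *)
definition CFL_advice :: "'a set \<Rightarrow> 'a list set set" where
  "CFL_advice \<Sigma> = {L. L \<subseteq> lists \<Sigma> \<and>
    (\<exists>(\<Theta> :: nat set) (h :: nat \<Rightarrow> nat list) S.
       alphabet \<Theta> \<and> (\<forall>n. h n \<in> words \<Theta> n) \<and> S \<in> CFL (\<Sigma> \<times> \<Theta>) \<and>
       (\<forall>x \<in> lists \<Sigma>. x \<in> L \<longleftrightarrow> zip x (h (length x)) \<in> S))}"

definition Delta :: "'g set \<Rightarrow> nat \<Rightarrow> nat \<Rightarrow> nat \<Rightarrow> (nat \<times> nat \<times> 'g \<times> 'g) set" where
  "Delta \<Gamma> j\<^sub>0 k\<^sub>0 n =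
    {(i, j, u, v). u \<in> \<Gamma> \<and> v \<in> \<Gamma> \<and> i \<in> {0..n} \<and> j \<in> {j\<^sub>0..k\<^sub>0} \<and> i + j \<le> n}"

end

theory Submission
  imports Defs "HOL-Library.Sublist"
begin

text \<open>
  Fix a grammar for the two-track language. Descending in a derivation tree towards the longer
  part of the yield, one meets a suffix \<open>\<beta>\<close> of some right-hand side whose yield has length in
  \<open>{j\<^sub>0..k\<^sub>0}\<close>; working with suffixes of right-hand sides instead of nonterminals makes
  the tree binary without any normal form. A factor \<open>y\<close> at position \<open>i\<close> is then indexed by its type,
  the \<^emph>\<open>set\<close> of all such suffixes deriving it together with its part of the advice. Every factor has
  exactly one type, so the product sets are disjoint, and whether \<open>x @ y @ z\<close> is derivable through
  some suffix deriving \<open>y\<close> depends on \<open>y\<close> only through its type.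
\<close>

section \<open>Derivations and yields of sentential forms\<close>

lemma cfg_steps_context:
  assumes "(\<alpha>, \<beta>) \<in> (cfg_step G)\<^sup>*"
  shows "(\<mu> @ \<alpha> @ \<nu>, \<mu> @ \<beta> @ \<nu>) \<in> (cfg_step G)\<^sup>*"
  using assms
proof (induction rule: rtrancl_induct)
  case base
  show ?case by simp
next
  case (step \<beta> \<gamma>)
  from step.hyps(2) obtain \<rho> X \<sigma> \<delta> where
    "\<beta> = \<rho> @ [NT X] @ \<sigma>" "\<gamma> = \<rho> @ \<delta> @ \<sigma>" "(X, \<delta>) \<in> productions G"
    unfolding cfg_step_def by auto
  then have "\<mu> @ \<beta> @ \<nu> = (\<mu> @ \<rho>) @ [NT X] @ (\<sigma> @ \<nu>)" "\<mu> @ \<gamma> @ \<nu> = (\<mu> @ \<rho>) @ \<delta> @ (\<sigma> @ \<nu>)"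
    by simp_all
  with \<open>(X, \<delta>) \<in> productions G\<close> have "(\<mu> @ \<beta> @ \<nu>, \<mu> @ \<gamma> @ \<nu>) \<in> cfg_step G"
    unfolding cfg_step_def by blast
  with step.IH show ?case by (rule rtrancl_into_rtrancl)
qed

lemma cfg_step_head:
  "(X, \<gamma>) \<in> productions G \<Longrightarrow> (NT X # \<alpha>, \<gamma> @ \<alpha>) \<in> cfg_step G"
  unfolding cfg_step_def by (force intro: exI[of _ "[]"])

text \<open>Derivation forests read as binary trees: rule \<open>NT\<close> branches into the chosen
  right-hand side and the remaining symbols. Rule induction then performs the descent, which a
  sequence of rewriting steps would not support directly.\<close>

inductive yields :: "('n, 't) cfg \<Rightarrow> ('n, 't) symb list \<Rightarrow> 't list \<Rightarrow> bool" for G where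
  Nil: "yields G [] []"
| TM: "yields G \<alpha> w \<Longrightarrow> yields G (TM a # \<alpha>) (a # w)"
| NT: "(X, \<gamma>) \<in> productions G \<Longrightarrow> yields G \<gamma> u \<Longrightarrow> yields G \<alpha> w \<Longrightarrow> yields G (NT X # \<alpha>) (u @ w)"

lemma yields_terminals: "yields G (map TM w) w"
  by (induction w) (auto intro: yields.intros)

lemma yields_append:
  assumes "yields G \<alpha> u" "yields G \<beta> v"
  shows "yields G (\<alpha> @ \<beta>) (u @ v)"
  using assms by (induction rule: yields.induct) (auto intro: yields.intros)

lemma yields_appendE:
  assumes "yields G (\<alpha> @ \<beta>) w"
  obtains u v where "w = u @ v" "yields G \<alpha> u" "yields G \<beta> v"
proof -
  have "\<exists>u v. w = u @ v \<and> yields G \<alpha> u \<and> yields G \<beta> v"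
    using assms
  proof (induction \<alpha> arbitrary: w)
    case Nil
    then show ?case using yields.Nil by fastforce
  next
    case (Cons s \<alpha>)
    from Cons.prems have "yields G (s # (\<alpha> @ \<beta>)) w" by simp
    then show ?case
    proof cases
      case (TM w' a)
      with Cons.IH obtain u v where "w' = u @ v" "yields G \<alpha> u" "yields G \<beta> v" by blast
      with TM show ?thesis by (intro exI[of _ "a # u"] exI[of _ v]) (auto intro: yields.TM)
    next
      case (NT X \<gamma> t w')
      with Cons.IH obtain u v where "w' = u @ v" "yields G \<alpha> u" "yields G \<beta> v" by blast
      with NT show ?thesis by (intro exI[of _ "t @ u"] exI[of _ v]) (auto intro: yields.NT)
    qed
  qed
  with that show thesis by blast
qed

text \<open>From left to right, derivations of the components are put into context and chained.
  Conversely, steps are undone starting from the terminal word: the yield splits around the inserted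
  right-hand side, and rule \<open>NT\<close> folds that piece back into the nonterminal.\<close>

lemma yields_iff_cfg_steps: "yields G \<alpha> w \<longleftrightarrow> (\<alpha>, map TM w) \<in> (cfg_step G)\<^sup>*"
proof
  assume "yields G \<alpha> w"
  then show "(\<alpha>, map TM w) \<in> (cfg_step G)\<^sup>*"
  proof (induction rule: yields.induct)
    case Nil
    show ?case by simp
  next
    case (TM \<alpha> w a)
    from cfg_steps_context[OF TM.IH, of "[TM a]" "[]"] show ?case by simp
  next
    case (NT X \<gamma> u \<alpha> w)
    have "(NT X # \<alpha>, \<gamma> @ \<alpha>) \<in> (cfg_step G)\<^sup>*"
      using NT.hyps(1) by (blast intro: cfg_step_head)
    also have "(\<gamma> @ \<alpha>, map TM u @ \<alpha>) \<in> (cfg_step G)\<^sup>*"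
      using cfg_steps_context[OF NT.IH(1), of "[]" \<alpha>] by simp
    also have "(map TM u @ \<alpha>, map TM u @ map TM w) \<in> (cfg_step G)\<^sup>*"
      using cfg_steps_context[OF NT.IH(2), of "map TM u" "[]"] by simp
    finally show ?case by simp
  qed
next
  assume "(\<alpha>, map TM w) \<in> (cfg_step G)\<^sup>*"
  then show "yields G \<alpha> w"
  proof (induction rule: converse_rtrancl_induct)
    case base
    show ?case by (rule yields_terminals)
  next
    case (step \<alpha> \<beta>)
    from step.hyps(1) obtain \<rho> X \<sigma> \<gamma> where
      X: "\<alpha> = \<rho> @ [NT X] @ \<sigma>" "\<beta> = \<rho> @ \<gamma> @ \<sigma>" "(X, \<gamma>) \<in> productions G"
      unfolding cfg_step_def by auto
    from step.IH X(2) obtain r g s where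
      "w = r @ g @ s" "yields G \<rho> r" "yields G \<gamma> g" "yields G \<sigma> s"
      by (metis yields_appendE)
    with X show ?case by (auto intro: yields_append yields.NT)
  qed
qed

section \<open>Factors of medium length\<close>

text \<open>A finite set of forms that contains the start form and is closed under both branches of
  rule \<open>NT\<close>: dropping the head, or passing to a right-hand side for it.\<close>

definition rhs_suffixes :: "('n, 't) cfg \<Rightarrow> ('n, 't) symb list set" where
  "rhs_suffixes G = (\<Union>\<gamma> \<in> insert [NT (start G)] (snd ` productions G). {\<beta>. suffix \<beta> \<gamma>})"

lemma finite_rhs_suffixes: "finite (productions G) \<Longrightarrow> finite (rhs_suffixes G)"
  \<comment> \<open>The suffixes of one right-hand side are the elements of a list, hence finitely
    many.\<close>
  unfolding rhs_suffixes_def by (auto simp flip: set_suffixes_eq)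

lemma rhs_suffixes_start: "[NT (start G)] \<in> rhs_suffixes G"
  unfolding rhs_suffixes_def by auto

lemma rhs_suffixes_rhs: "(X, \<gamma>) \<in> productions G \<Longrightarrow> \<gamma> \<in> rhs_suffixes G"
  unfolding rhs_suffixes_def by force

lemma rhs_suffixes_ConsD: "s # \<alpha> \<in> rhs_suffixes G \<Longrightarrow> \<alpha> \<in> rhs_suffixes G"
  unfolding rhs_suffixes_def by (auto dest: suffix_ConsD)

text \<open>As long as the yield is longer than \<open>k\<close>, one branch yields at least
  \<open>j\<close> symbols, because two parts shorter than \<open>j\<close> have total length below
  \<open>2 * j \<le> k\<close>. The descent stops at the first yield of length at most
  \<open>k\<close>. The context is kept as a derivation, so that \<beta> may later be given a
  different yield.\<close>

lemma yields_medium_factor: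
  assumes "yields G \<alpha> w" "\<alpha> \<in> rhs_suffixes G" "k < length w" "2 * j \<le> k"
  shows "\<exists>x y z \<beta>. w = x @ y @ z \<and> j \<le> length y \<and> length y \<le> k \<and> \<beta> \<in> rhs_suffixes G \<and>
    yields G \<beta> y \<and> (\<alpha>, map TM x @ \<beta> @ map TM z) \<in> (cfg_step G)\<^sup>*"
    (is "?P \<alpha> w")
proof -
  \<comment> \<open>One step of the descent: either \<open>w\<close> is still too long and the
    factor found inside it is used, with the two contexts composed, or \<open>w\<close> itself is
    the factor.\<close>
  have lift: "?P \<alpha> (x @ w @ z)"
    if "k < length w \<Longrightarrow> ?P \<beta> w" "j \<le> length w" "\<beta> \<in> rhs_suffixes G" "yields G \<beta> w"
      and steps: "(\<alpha>, map TM x @ \<beta> @ map TM z) \<in> (cfg_step G)\<^sup>*"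
    for \<alpha> \<beta> x w z
  proof (cases "k < length w")
    case True
    with that(1) obtain x' y z' \<delta> where w: "w = x' @ y @ z'"
      and y: "j \<le> length y" "length y \<le> k" "\<delta> \<in> rhs_suffixes G" "yields G \<delta> y"
      and \<delta>: "(\<beta>, map TM x' @ \<delta> @ map TM z') \<in> (cfg_step G)\<^sup>*"
      by blast
    note steps
    also note cfg_steps_context[OF \<delta>, of "map TM x" "map TM z"]
    finally have "(\<alpha>, map TM (x @ x') @ \<delta> @ map TM (z' @ z)) \<in> (cfg_step G)\<^sup>*"
      by simp
    moreover have "x @ w @ z = (x @ x') @ y @ (z' @ z)" by (simp add: w)
    ultimately show ?thesis using y by blast
  next
    case False
    then have "length w \<le> k" by simp
    with that(2-5) show ?thesis
      by (intro exI[of _ x] exI[of _ w] exI[of _ z] exI[of _ \<beta>] conjI refl)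
  qed
  from assms show ?thesis
  proof (induction rule: yields.induct)
    case Nil
    then show ?case by simp
  next
    case (TM \<alpha> w a)
    have \<alpha>: "\<alpha> \<in> rhs_suffixes G" using TM.prems(1) by (rule rhs_suffixes_ConsD)
    from lift[where \<beta> = \<alpha> and w = w and \<alpha> = "TM a # \<alpha>" and x = "[a]" and z = "[]"] \<alpha> TM show ?case by simp
  next
    case (NT X \<gamma> u \<alpha> w)
    have \<alpha>: "\<alpha> \<in> rhs_suffixes G" using NT.prems(1) by (rule rhs_suffixes_ConsD)
    have \<gamma>: "\<gamma> \<in> rhs_suffixes G" using NT.hyps(1) by (rule rhs_suffixes_rhs)
    have step: "(NT X # \<alpha>, \<gamma> @ \<alpha>) \<in> (cfg_step G)\<^sup>*"
      using NT.hyps(1) by (blast intro: cfg_step_head)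
    show ?case
    \<comment> \<open>The descent enters the tail if its yield is long enough, and otherwise the
      right-hand side \<gamma>, whose yield \<open>u\<close> then has more than \<open>j\<close>
      symbols. The branch not entered is derived to terminals and joins the context.\<close>
    proof (cases "j \<le> length w")
      case True
      note step
      also have "(\<gamma> @ \<alpha>, map TM u @ \<alpha>) \<in> (cfg_step G)\<^sup>*"
        using cfg_steps_context[of \<gamma> "map TM u" G "[]" \<alpha>] NT.hyps(2)
        by (simp add: yields_iff_cfg_steps)
      finally show ?thesis
        using lift[where \<beta> = \<alpha> and w = w and \<alpha> = "NT X # \<alpha>" and x = u and z = "[]"] True \<alpha> NT by simp
    next
      case False
      note step
      also have "(\<gamma> @ \<alpha>, \<gamma> @ map TM w) \<in> (cfg_step G)\<^sup>*"
        using cfg_steps_context[of \<alpha> "map TM w" G \<gamma> "[]"] NT.hyps(3)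
        by (simp add: yields_iff_cfg_steps)
      finally show ?thesis
        using lift[where \<beta> = \<gamma> and w = u and \<alpha> = "NT X # \<alpha>" and x = "[]" and z = w] False \<gamma> NT by simp
    qed
  qed
qed

section \<open>Types of factors and the product sets\<close>

lemma zip_append3:
  assumes "length h = length x + length y + length z"
  shows "zip (x @ y @ z) h =
    zip x (take (length x) h) @ zip y (take (length y) (drop (length x) h)) @
    zip z (drop (length x + length y) h)"
  using assms by (simp add: zip_append1 add.commute)

theorem lemma4p1:
  fixes \<Sigma> :: "'a set" and L :: "'a list set"
  assumes "alphabet \<Sigma>" and "card \<Sigma> \<ge> 2"
    and "L \<subseteq> lists \<Sigma>"
    and "L \<in> CFL_advice \<Sigma>"
  shows "\<exists>\<Gamma> :: nat set. alphabet \<Gamma> \<and>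
    (\<forall>j\<^sub>0 k\<^sub>0 n :: nat. j\<^sub>0 \<ge> 2 \<and> 2 * j\<^sub>0 \<le> k\<^sub>0 \<and> k\<^sub>0 < n \<longrightarrow>
      (\<exists>(A :: nat \<times> nat \<times> nat \<times> nat \<Rightarrow> ('a list \<times> 'a list) set)
        (B :: nat \<times> nat \<times> nat \<times> nat \<Rightarrow> 'a list set).
        (\<forall>(i, j, u, v) \<in> Delta \<Gamma> j\<^sub>0 k\<^sub>0 n.
           A (i, j, u, v) \<subseteq> words \<Sigma> i \<times> words \<Sigma> (n - i - j) \<and>
           B (i, j, u, v) \<subseteq> words \<Sigma> j) \<and>
        (\<forall>w \<in> words \<Sigma> n. length w \<ge> 4 \<longrightarrow>
           (w \<in> L \<longleftrightarrow>
             (\<exists>(i, j, u, v) \<in> Delta \<Gamma> j\<^sub>0 k\<^sub>0 n.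
                \<exists>x \<in> words \<Sigma> i. \<exists>y \<in> words \<Sigma> j. \<exists>z \<in> words \<Sigma> (n - i - j).
                  w = x @ y @ z \<and> (x, z) \<in> A (i, j, u, v) \<and> y \<in> B (i, j, u, v)))) \<and>
        (\<forall>e \<in> Delta \<Gamma> j\<^sub>0 k\<^sub>0 n.
           \<forall>x\<^sub>1 \<in> lists \<Sigma>. \<forall>x\<^sub>2 \<in> lists \<Sigma>. \<forall>y\<^sub>1 \<in> lists \<Sigma>.
           \<forall>y\<^sub>2 \<in> lists \<Sigma>. \<forall>z\<^sub>1 \<in> lists \<Sigma>. \<forall>z\<^sub>2 \<in> lists \<Sigma>.
             ((x\<^sub>1, z\<^sub>1), y\<^sub>1) \<in> A e \<times> B e \<and> ((x\<^sub>2, z\<^sub>2), y\<^sub>2) \<in> A e \<times> B e \<longrightarrow>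
             ((x\<^sub>1, z\<^sub>1), y\<^sub>2) \<in> A e \<times> B e \<and> ((x\<^sub>2, z\<^sub>2), y\<^sub>1) \<in> A e \<times> B e) \<and>
        disjoint_family_on (\<lambda>e. A e \<times> B e) (Delta \<Gamma> j\<^sub>0 k\<^sub>0 n)))"
    (is "\<exists>\<Gamma>. _ \<Gamma> \<and> (\<forall>j\<^sub>0 k\<^sub>0 n. _ j\<^sub>0 k\<^sub>0 n \<longrightarrow> (\<exists>A B. ?Q \<Gamma> j\<^sub>0 k\<^sub>0 n A B))")
proof -
  obtain \<Theta> :: "nat set" and h :: "nat \<Rightarrow> nat list" and S where
    h: "\<And>n. h n \<in> words \<Theta> n" and S: "S \<in> CFL (\<Sigma> \<times> \<Theta>)"
    and L: "\<And>x. x \<in> lists \<Sigma> \<Longrightarrow> x \<in> L \<longleftrightarrow> zip x (h (length x)) \<in> S"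
    using assms(4) unfolding CFL_advice_def by blast
  obtain G :: "(nat, 'a \<times> nat) cfg" where
    G: "wf_cfg G" "terminals G = \<Sigma> \<times> \<Theta>" "cfg_lang G = S"
    using S unfolding CFL_def by blast
  let ?I = "rhs_suffixes G"
  have len_h: "length (h n) = n" for n
    using h[of n] by (simp add: words_def)
  have L_iff: "w \<in> L \<longleftrightarrow> yields G [NT (start G)] (zip w (h n))" if "w \<in> words \<Sigma> n" for w n
  proof -
    have w: "w \<in> lists \<Sigma>" "length w = n" using that by (auto simp: words_def)
    have "zip w (h n) \<in> lists (\<Sigma> \<times> \<Theta>)"
      using w h[of n] by (auto simp: words_def in_lists_conv_set dest: set_zip_leftD set_zip_rightD)
    then show ?thesis
      using L[OF w(1)] w(2) G(2,3) by (auto simp: cfg_lang_def yields_iff_cfg_steps)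
  qed
  have "finite (Pow ?I)"
    using G(1) by (simp add: wf_cfg_def finite_rhs_suffixes)
  \<comment> \<open>Types are sets of forms; \<open>f\<close> codes them as numbers. The resulting
    \<Gamma> depends on the grammar only, not on \<open>j\<^sub>0\<close>, \<open>k\<^sub>0\<close>
    or \<open>n\<close>.\<close>
  then obtain f :: "(nat, 'a \<times> nat) symb list set \<Rightarrow> nat" where f: "inj_on f (Pow ?I)"
    using finite_imp_inj_to_nat_seg by metis
  define \<Gamma> where "\<Gamma> = f ` Pow ?I"
  define T where "T n i y = {\<beta> \<in> ?I. yields G \<beta> (zip y (take (length y) (drop i (h n))))}" for n i y
  \<comment> \<open>The contexts that accept some form of the type coded by \<open>u\<close>. Since
    \<open>f\<close> is injective on \<open>Pow ?I\<close>, the existential over \<open>t\<close>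
    merely decodes \<open>u\<close>.\<close>
  define A :: "nat \<Rightarrow> nat \<times> nat \<times> nat \<times> nat \<Rightarrow> ('a list \<times> 'a list) set" where
    "A n = (\<lambda>(i, j, u, v). {(x, z). x \<in> words \<Sigma> i \<and> z \<in> words \<Sigma> (n - i - j) \<and>
      (\<exists>t \<in> Pow ?I. f t = u \<and> (\<exists>\<beta> \<in> t. ([NT (start G)],
        map TM (zip x (take i (h n))) @ \<beta> @ map TM (zip z (drop (i + j) (h n)))) \<in> (cfg_step G)\<^sup>*))})"
    for n
  \<comment> \<open>One index symbol suffices, so the index set is cut down to the diagonal \<open>u = v\<close>.\<close>
  define B :: "nat \<Rightarrow> nat \<times> nat \<times> nat \<times> nat \<Rightarrow> 'a list set" where
    "B n = (\<lambda>(i, j, u, v). {y \<in> words \<Sigma> j. f (T n i y) = u \<and> u = v})" for n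
  have T_sub: "T n i y \<in> Pow ?I" for n i y
    by (auto simp: T_def)
  have correct: "w \<in> L \<longleftrightarrow>
      (\<exists>(i, j, u, v) \<in> Delta \<Gamma> j\<^sub>0 k\<^sub>0 n.
        \<exists>x \<in> words \<Sigma> i. \<exists>y \<in> words \<Sigma> j. \<exists>z \<in> words \<Sigma> (n - i - j).
          w = x @ y @ z \<and> (x, z) \<in> A n (i, j, u, v) \<and> y \<in> B n (i, j, u, v))" (is "_ \<longleftrightarrow> ?R")
    if jk: "2 * j\<^sub>0 \<le> k\<^sub>0" "k\<^sub>0 < n" and w: "w \<in> words \<Sigma> n" for j\<^sub>0 k\<^sub>0 n w
  proof
    assume "w \<in> L"
    then have "yields G [NT (start G)] (zip w (h n))" using L_iff[OF w] by simp
    moreover have "k\<^sub>0 < length (zip w (h n))" using w jk(2) by (simp add: words_def len_h)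
    ultimately obtain p q r \<beta> where
      zip: "zip w (h n) = p @ q @ r" and q: "j\<^sub>0 \<le> length q" "length q \<le> k\<^sub>0"
      and \<beta>: "\<beta> \<in> ?I" "yields G \<beta> q"
      and steps: "([NT (start G)], map TM p @ \<beta> @ map TM r) \<in> (cfg_step G)\<^sup>*"
      using yields_medium_factor[OF _ rhs_suffixes_start _ jk(1)] by blast
    \<comment> \<open>The first track recovers the factors of \<open>w\<close>; comparing lengths
      then shows that the second tracks are the matching pieces of \<open>h n\<close>.\<close>
    define x y z where "x = map fst p" and "y = map fst q" and "z = map fst r"
    have len: "length w = n" using w by (simp add: words_def)
    have "w = map fst (zip w (h n))" by (simp add: len len_h)
    then have xyz: "w = x @ y @ z" by (simp add: zip x_def y_def z_def)
    have "p @ q @ r = zip x (take (length x) (h n)) @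
        zip y (take (length y) (drop (length x) (h n))) @ zip z (drop (length x + length y) (h n))"
      unfolding zip[symmetric] xyz by (rule zip_append3) (use len xyz in \<open>simp add: len_h\<close>)
    moreover have "length p = length x" "length q = length y" by (simp_all add: x_def y_def)
    ultimately have pqr: "p = zip x (take (length x) (h n))"
      "q = zip y (take (length y) (drop (length x) (h n)))"
      "r = zip z (drop (length x + length y) (h n))"
      using len xyz by (auto simp: append_eq_append_conv len_h)
    have words: "x \<in> words \<Sigma> (length x)" "y \<in> words \<Sigma> (length y)"
      "z \<in> words \<Sigma> (n - length x - length y)"
      using w len xyz by (auto simp: words_def)
    let ?u = "f (T n (length x) y)"
    have "\<beta> \<in> T n (length x) y" using \<beta> pqr by (simp add: T_def)
    then have "(x, z) \<in> A n (length x, length y, ?u, ?u)"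
      using steps words(1,3) T_sub[of n "length x" y] unfolding A_def pqr by blast
    moreover have "y \<in> B n (length x, length y, ?u, ?u)"
      using words by (simp add: B_def)
    moreover have "(length x, length y, ?u, ?u) \<in> Delta \<Gamma> j\<^sub>0 k\<^sub>0 n"
      using T_sub q len xyz by (auto simp: Delta_def \<Gamma>_def y_def)
    ultimately show ?R using words xyz by blast
  next
    assume ?R
    then obtain i j u v x y z where
      words: "x \<in> words \<Sigma> i" "y \<in> words \<Sigma> j" and xyz: "w = x @ y @ z"
      and A: "(x, z) \<in> A n (i, j, u, v)" and B: "y \<in> B n (i, j, u, v)"
      by blast
    have len: "length x = i" "length y = j" "length w = n"
      using words w by (simp_all add: words_def)
    from A obtain t \<beta> where t: "t \<in> Pow ?I" "f t = u" "\<beta> \<in> t"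
      and steps: "([NT (start G)], map TM (zip x (take i (h n))) @ \<beta> @
        map TM (zip z (drop (i + j) (h n)))) \<in> (cfg_step G)\<^sup>*"
      by (auto simp: A_def)
    \<comment> \<open>The type decoded from the context must be the type of \<open>y\<close>, so the
      form \<beta> that fits the context also derives this \<open>y\<close> with its advice.\<close>
    from B have "f (T n i y) = u" by (simp add: B_def)
    with t f T_sub have "t = T n i y" by (metis inj_onD)
    with t(3) have "yields G \<beta> (zip y (take j (drop i (h n))))"
      by (simp add: T_def len)
    then have \<beta>: "(\<beta>, map TM (zip y (take j (drop i (h n))))) \<in> (cfg_step G)\<^sup>*"
      by (simp add: yields_iff_cfg_steps)
    have "zip w (h n) = zip x (take i (h n)) @ zip y (take j (drop i (h n))) @
        zip z (drop (i + j) (h n))"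
      unfolding xyz len(1,2)[symmetric] by (rule zip_append3) (use len xyz in \<open>simp add: len_h\<close>)
    with rtrancl_trans[OF steps cfg_steps_context[OF \<beta>]]
    have "yields G [NT (start G)] (zip w (h n))"
      by (simp add: yields_iff_cfg_steps)
    then show "w \<in> L" using L_iff[OF w] by simp
  qed
  \<comment> \<open>A triple determines its index: the lengths of \<open>x\<close> and
    \<open>y\<close> give \<open>i\<close> and \<open>j\<close>, and the type of \<open>y\<close>
    gives \<open>u = v\<close>.\<close>
  have disjoint: "disjoint_family_on (\<lambda>e. A n e \<times> B n e) D" for n D
    unfolding disjoint_family_on_def by (auto simp: A_def B_def words_def)
  have words: "\<forall>(i, j, u, v) \<in> D.
      A n (i, j, u, v) \<subseteq> words \<Sigma> i \<times> words \<Sigma> (n - i - j) \<and> B n (i, j, u, v) \<subseteq> words \<Sigma> j" for n D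
    by (auto simp: A_def B_def)
  have "alphabet \<Gamma>"
    using \<open>finite (Pow ?I)\<close> unfolding alphabet_def \<Gamma>_def by blast
  moreover have "\<exists>A B. ?Q \<Gamma> j\<^sub>0 k\<^sub>0 n A B"
    if "2 \<le> j\<^sub>0 \<and> 2 * j\<^sub>0 \<le> k\<^sub>0 \<and> k\<^sub>0 < n" for j\<^sub>0 k\<^sub>0 n
  proof (rule exI[of _ "A n"], rule exI[of _ "B n"], intro conjI)
    show "\<forall>w \<in> words \<Sigma> n. length w \<ge> 4 \<longrightarrow> (w \<in> L \<longleftrightarrow>
        (\<exists>(i, j, u, v) \<in> Delta \<Gamma> j\<^sub>0 k\<^sub>0 n.
          \<exists>x \<in> words \<Sigma> i. \<exists>y \<in> words \<Sigma> j. \<exists>z \<in> words \<Sigma> (n - i - j).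
            w = x @ y @ z \<and> (x, z) \<in> A n (i, j, u, v) \<and> y \<in> B n (i, j, u, v)))"
      using that by (intro ballI impI correct) auto
  \<comment> \<open>The exchange property is left to \<open>blast\<close>, since it holds in every
    Cartesian product.\<close>
  qed (rule words | rule disjoint | blast)+
  ultimately show ?thesis by blast
qed

end
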